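(* Let $G_S$ be the self-loop graph of a finite simple graph $G$ of order $n \geq 2$ and size $m \geq 1$, where $S\subseteq V(G)$ and $|S|=\sigma$. Then $$\lambda_1(G_S) \leq \frac{\sigma}{n} + \sqrt{\frac{\sigma(n-1)(n-\sigma)}{n^2} + \frac{2m(n-1)}{n}}.$$
   Context: The size $m$ is the number of edges of $G$ (loops are not counted). The self-loop graph $G_S$ is obtained from $G$ by attaching one loop at each vertex of $S$; its adjacency matrix is $A(G_S)=A(G)+\mathfrak{I}_S$, where $\mathfrak{I}_S$ is the diagonal $0/1$ matrix with ones exactly at the positions corresponding to $S$. $\lambda_1(G_S)$ denotes the largest eigenvalue of $A(G_S)$ (the spectral radius). *)

theory Defs
  imports
    Complex_Main
    "Graph_Theory.Digraph"
    "Jordan_Normal_Form.Spectral_Radius"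
begin

text \<open>
  Finite simple graphs are rendered by the locale \<^locale>\<open>graph\<close>: finite symmetric digraphs without
  loops or parallel arcs. An undirected edge is thus a pair of opposite arcs, and the size counts
  such pairs once, via their two-element set of endpoints.
\<close>

definition edges :: "('v, 'e) pre_digraph \<Rightarrow> 'v set set" where
  "edges G = (\<lambda>e. {tail G e, head G e}) ` arcs G"

definition graph_size :: "('v, 'e) pre_digraph \<Rightarrow> nat" where
  "graph_size G = card (edges G)"

text \<open>
  Rows and columns of a matrix are numbered, so the matrices below take an enumeration \<open>vs\<close> of the
  vertices, in which the \<open>i\<close>-th row and column belong to the vertex \<open>vs ! i\<close>.
\<close>

definition vertex_enum :: "('v, 'e) pre_digraph \<Rightarrow> 'v list \<Rightarrow> bool" where
  "vertex_enum G vs \<longleftrightarrow> distinct vs \<and> set vs = verts G"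

definition adj_matrix :: "('v, 'e) pre_digraph \<Rightarrow> 'v list \<Rightarrow> real mat" where
  "adj_matrix G vs =
     mat (length vs) (length vs) (\<lambda>(i, j). if {vs ! i, vs ! j} \<in> edges G then 1 else 0)"

definition loop_matrix :: "'v set \<Rightarrow> 'v list \<Rightarrow> real mat" where
  "loop_matrix S vs =
     mat (length vs) (length vs) (\<lambda>(i, j). if i = j \<and> vs ! i \<in> S then 1 else 0)"

definition self_loop_adj_matrix :: "('v, 'e) pre_digraph \<Rightarrow> 'v set \<Rightarrow> 'v list \<Rightarrow> real mat" where
  "self_loop_adj_matrix G S vs = adj_matrix G vs + loop_matrix S vs"

text \<open>
  For a real symmetric matrix of positive dimension all complex eigenvalues are real, so the real
  spectrum is finite, nonempty and misses no eigenvalue. For other matrices the value need not be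
  meaningful.
\<close>

definition largest_eigenvalue :: "real mat \<Rightarrow> real" where
  "largest_eigenvalue A = Max (spectrum A)"

definition lambda1 :: "('v, 'e) pre_digraph \<Rightarrow> 'v set \<Rightarrow> 'v list \<Rightarrow> real" where
  "lambda1 G S vs = largest_eigenvalue (self_loop_adj_matrix G S vs)"

end

theory Submission
  imports Defs "HOL-Analysis.Convex"
begin

text \<open>Let k be an eigenvalue of an n by n matrix A with eigenvector x, q the squared norm of
  x, t the trace of A and N its squared Frobenius norm. Removing the multiples of the identity from
  A and from the rank-one matrix of x leaves two trace-free matrices with inner product (k - t/n) q
  and squared norms N - t^2/n and q^2 (1 - 1/n). Cauchy-Schwarz then bounds (k - t/n)^2; this is
  \<open>eigenvalue_trace_bound\<close>.

  For the self-loop graph, t = \<sigma> because only loops reach the diagonal, and N = 2m + \<sigma>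
  because every edge gives two off-diagonal ones (\<open>card_adjacent_pairs\<close>). Substituting
  and taking a square root gives the theorem. That \<open>Max\<close> of the real spectrum is an
  eigenvalue at all rests on symmetry, through \<open>symmetric_spectrum_nonempty\<close>.\<close>

lemma eigenvalue_coords:
  fixes A :: "'a :: field mat"
  assumes A: "A \<in> carrier_mat n n" and ev: "eigenvalue A k"
  obtains x where "\<exists>i<n. x i \<noteq> 0" "\<And>i. i < n \<Longrightarrow> (\<Sum>j<n. A $$ (i, j) * x j) = k * x i"
proof -
  from ev A obtain v where v: "v \<in> carrier_vec n" "v \<noteq> 0\<^sub>v n" "A *\<^sub>v v = k \<cdot>\<^sub>v v"
    unfolding eigenvalue_def eigenvector_def by auto
  have "\<exists>i<n. v $ i \<noteq> 0"
  proof (rule ccontr)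
    assume "\<not> ?thesis"
    then have "v = 0\<^sub>v n" using v(1) by (intro eq_vecI) auto
    with v(2) show False by simp
  qed
  moreover have "(\<Sum>j<n. A $$ (i, j) * v $ j) = k * v $ i" if i: "i < n" for i
  proof -
    have "(A *\<^sub>v v) $ i = (\<Sum>j<n. A $$ (i, j) * v $ j)"
      using A v(1) i by (auto simp: scalar_prod_def atLeast0LessThan intro!: sum.cong)
    then show ?thesis using v i by simp
  qed
  ultimately show thesis using that by blast
qed

text \<open>The form \<open>Q\<close>, the Hermitian form of A at an eigenvector, equals k times the
  positive real \<open>q\<close>. Conjugating it only swaps the two summation indices, which
  symmetry undoes, so \<open>Q\<close> is real and hence k is.\<close>

lemma symmetric_eigenvalue_real:
  fixes A :: "real mat" and k :: complex
  assumes A: "A \<in> carrier_mat n n"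
    and sym: "\<And>i j. i < n \<Longrightarrow> j < n \<Longrightarrow> A $$ (i, j) = A $$ (j, i)"
    and ev: "eigenvalue (map_mat of_real A) k"
  shows "Im k = 0"
proof -
  have "map_mat of_real A \<in> carrier_mat n n" using A by simp
  from eigenvalue_coords[OF this ev] obtain x where
    nz: "\<exists>i<n. x i \<noteq> 0" and
    ev0: "\<And>i. i < n \<Longrightarrow> (\<Sum>j<n. map_mat of_real A $$ (i, j) * x j) = k * x i"
    by blast
  have ev: "(\<Sum>j<n. of_real (A $$ (i, j)) * x j) = k * x i" if "i < n" for i
    using ev0[OF that] A that by simp
  define q :: real where "q = (\<Sum>i<n. (cmod (x i))\<^sup>2)"
  have "q > 0" unfolding q_def using nz by (auto intro!: sum_pos2)
  define Q where "Q = (\<Sum>i<n. \<Sum>j<n. of_real (A $$ (i, j)) * (cnj (x i) * x j))"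
  have "Q = (\<Sum>i<n. cnj (x i) * (k * x i))"
    unfolding Q_def by (intro sum.cong refl) (simp add: ev[symmetric] sum_distrib_left mult_ac)
  also have "\<dots> = k * of_real q"
    unfolding q_def of_real_sum sum_distrib_left
    by (intro sum.cong refl) (simp only: complex_norm_square mult_ac)
  finally have Q: "Q = k * of_real q" .
  have "cnj Q = (\<Sum>i<n. \<Sum>j<n. of_real (A $$ (i, j)) * (cnj (x j) * x i))"
    unfolding Q_def by (simp add: mult_ac)
  also have "\<dots> = (\<Sum>j<n. \<Sum>i<n. of_real (A $$ (i, j)) * (cnj (x j) * x i))"
    by (rule sum.swap)
  also have "\<dots> = Q" unfolding Q_def by (intro sum.cong refl) (simp add: sym)
  finally have "Im Q = 0" by (metis Reals_cnj_iff complex_is_Real_iff)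
  with Q \<open>q > 0\<close> show ?thesis by simp
qed

text \<open>Over the complex numbers an eigenvalue always exists. By symmetry it is real, so it is
  already a root of the real characteristic polynomial.\<close>

lemma symmetric_spectrum_nonempty:
  fixes A :: "real mat"
  assumes A: "A \<in> carrier_mat n n" and n: "n > 0"
    and sym: "\<And>i j. i < n \<Longrightarrow> j < n \<Longrightarrow> A $$ (i, j) = A $$ (j, i)"
  shows "spectrum A \<noteq> {}"
proof -
  let ?C = "map_mat complex_of_real A"
  have C: "?C \<in> carrier_mat n n" using A by simp
  from spectrum_non_empty[OF C n] obtain k where k: "eigenvalue ?C k"
    unfolding spectrum_def by auto
  from symmetric_eigenvalue_real[OF A sym k] have "k = of_real (Re k)"
    by (simp add: complex_eq_iff)
  moreover have "poly (char_poly ?C) k = 0" using k eigenvalue_root_char_poly[OF C] by simp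
  ultimately have "poly (map_poly of_real (char_poly A)) (complex_of_real (Re k)) = 0"
    using of_real_hom.char_poly_hom[OF A] by metis
  then have "poly (char_poly A) (Re k) = 0" by (simp add: of_real_hom.poly_map_poly)
  then show ?thesis using eigenvalue_root_char_poly[OF A] unfolding spectrum_def by auto
qed

text \<open>
  Cauchy--Schwarz for the Frobenius inner product of \<open>A - (t/n) I\<close> with the trace-free matrix
  \<open>x x\<^sup>T - (q/n) I\<close>, where \<open>x\<close> is an eigenvector, \<open>q\<close> its squared norm and \<open>t\<close> the trace of \<open>A\<close>.
\<close>

lemma eigenvalue_trace_bound:
  fixes A :: "real mat"
  assumes A: "A \<in> carrier_mat n n" and n: "n > 0" and ev: "eigenvalue A k"
  defines "t \<equiv> (\<Sum>i<n. A $$ (i, i))"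
  shows "(k - t / n)\<^sup>2 \<le> ((\<Sum>i<n. \<Sum>j<n. (A $$ (i, j))\<^sup>2) - t\<^sup>2 / n) * (1 - 1 / n)"
proof -
  from eigenvalue_coords[OF A ev] obtain x where
    nz: "\<exists>i<n. x i \<noteq> 0" and ev: "\<And>i. i < n \<Longrightarrow> (\<Sum>j<n. A $$ (i, j) * x j) = k * x i"
    by blast
  define q where "q = (\<Sum>i<n. (x i)\<^sup>2)"
  have q: "q > 0" unfolding q_def using nz by (auto intro!: sum_pos2)
  define N where "N = (\<Sum>i<n. \<Sum>j<n. (A $$ (i, j))\<^sup>2)"
  \<comment> \<open>The entries of the identity matrix. Collecting all identity terms into one
    multiple of \<open>d\<close> lets the next fact collapse them to a sum over the
    diagonal.\<close>
  define d :: "nat \<Rightarrow> nat \<Rightarrow> real" where "d i j = (if i = j then 1 else 0)" for i j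
  have d: "(\<Sum>i<n. \<Sum>j<n. f i j * d i j) = (\<Sum>i<n. f i i)" for f :: "nat \<Rightarrow> nat \<Rightarrow> real"
    by (intro sum.cong refl) (simp add: d_def if_distrib cong: if_cong)
  have dd: "d i j * d i j = d i j" for i j by (simp add: d_def)
  define f where "f i j = A $$ (i, j) - t / n * d i j" for i j
  define g where "g i j = x i * x j - q / n * d i j" for i j
  \<comment> \<open>The only place where the eigenvector equation enters.\<close>
  have "(\<Sum>i<n. \<Sum>j<n. A $$ (i, j) * (x i * x j)) = (\<Sum>i<n. x i * (k * x i))"
    by (intro sum.cong refl) (simp add: ev[symmetric] sum_distrib_left mult_ac)
  also have "\<dots> = k * q" unfolding q_def sum_distrib_left
    by (intro sum.cong refl) (simp add: power2_eq_square)
  finally have quad: "(\<Sum>i<n. \<Sum>j<n. A $$ (i, j) * (x i * x j)) = k * q" .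
  have "f i j * g i j = A $$ (i, j) * (x i * x j)
      - (q / n * A $$ (i, j) + t / n * (x i * x j) - t / n * (q / n)) * d i j" for i j
    unfolding f_def g_def by (simp add: dd[of i j] algebra_simps)
  then have "(\<Sum>i<n. \<Sum>j<n. f i j * g i j) = k * q
      - (\<Sum>i<n. q / n * A $$ (i, i) + t / n * (x i * x i) - t / n * (q / n))"
    by (simp only: sum_subtractf d quad)
  also have "(\<Sum>i<n. q / n * A $$ (i, i) + t / n * (x i * x i) - t / n * (q / n)) = t * q / n"
    using n by (simp add: sum.distrib sum_subtractf t_def q_def power2_eq_square
        flip: sum_distrib_left sum_divide_distrib)
  also have "k * q - t * q / n = (k - t / n) * q" by (simp add: algebra_simps)
  finally have fg: "(\<Sum>i<n. \<Sum>j<n. f i j * g i j) = (k - t / n) * q" .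
  have "(f i j)\<^sup>2 = (A $$ (i, j))\<^sup>2 - (2 * (t / n) * A $$ (i, j) - (t / n)\<^sup>2) * d i j" for i j
    unfolding f_def by (simp add: d_def power2_eq_square algebra_simps)
  then have "(\<Sum>i<n. \<Sum>j<n. (f i j)\<^sup>2) = N - (\<Sum>i<n. 2 * (t / n) * A $$ (i, i) - (t / n)\<^sup>2)"
    by (simp only: sum_subtractf d N_def)
  also have "\<dots> = N - t\<^sup>2 / n"
    unfolding sum_subtractf sum_distrib_left[symmetric] t_def[symmetric]
    using n by (simp add: power2_eq_square field_simps)
  finally have ff: "(\<Sum>i<n. \<Sum>j<n. (f i j)\<^sup>2) = N - t\<^sup>2 / n" .
  have "(g i j)\<^sup>2 = (x i)\<^sup>2 * (x j)\<^sup>2 - (2 * (q / n) * (x i)\<^sup>2 - (q / n)\<^sup>2) * d i j" for i j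
    unfolding g_def by (simp add: d_def power2_eq_square algebra_simps)
  then have "(\<Sum>i<n. \<Sum>j<n. (g i j)\<^sup>2)
      = q * q - (\<Sum>i<n. 2 * (q / n) * (x i)\<^sup>2 - (q / n)\<^sup>2)"
    by (simp only: sum_subtractf d q_def sum_product)
  also have "\<dots> = q\<^sup>2 * (1 - 1 / n)"
    unfolding sum_subtractf sum_distrib_left[symmetric] q_def[symmetric]
    using n by (simp add: power2_eq_square field_simps)
  finally have gg: "(\<Sum>i<n. \<Sum>j<n. (g i j)\<^sup>2) = q\<^sup>2 * (1 - 1 / n)" .
  let ?I = "{..<n} \<times> {..<n}"
  have "(\<Sum>(i, j)\<in>?I. f i j * g i j)\<^sup>2 \<le> (\<Sum>(i, j)\<in>?I. (f i j)\<^sup>2) * (\<Sum>(i, j)\<in>?I. (g i j)\<^sup>2)"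
    using Cauchy_Schwarz_ineq_sum[of "\<lambda>(i, j). f i j" "\<lambda>(i, j). g i j" ?I]
    by (simp add: case_prod_beta)
  then have "((k - t / n) * q)\<^sup>2 \<le> (N - t\<^sup>2 / n) * (q\<^sup>2 * (1 - 1 / n))"
    by (simp only: sum.cartesian_product[symmetric] fg ff gg)
  then have "(k - t / n)\<^sup>2 * q\<^sup>2 \<le> ((N - t\<^sup>2 / n) * (1 - 1 / n)) * q\<^sup>2"
    by (simp add: power_mult_distrib mult_ac)
  then show ?thesis using q unfolding N_def by (simp only: mult_le_cancel_right_pos zero_less_power)
qed

text \<open>A loop would have a singleton as its endpoint set. This keeps the diagonal of the
  adjacency matrix zero and gives every edge two distinct endpoints.\<close>

lemma singleton_notin_edges:
  assumes "graph G"
  shows "{u} \<notin> edges G"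
proof -
  interpret graph G by fact
  show ?thesis using no_loops unfolding edges_def by (fastforce simp: doubleton_eq_iff)
qed

text \<open>Handshake count: the ordered pairs split into disjoint fibres over the edges, and each
  fibre consists of the two orientations of its edge.\<close>

lemma card_adjacent_pairs:
  assumes G: "graph G"
  shows "card {(u, v). {u, v} \<in> edges G} = 2 * graph_size G"
proof -
  interpret graph G by fact
  let ?P = "\<lambda>e. {(u, v). {u, v} = e}"
  have card_P: "card (?P e) = 2 \<and> finite (?P e)" if "e \<in> edges G" for e
  proof -
    from that obtain a b where e: "e = {a, b}" unfolding edges_def by auto
    with that singleton_notin_edges[OF G, of a] have "a \<noteq> b" by auto
    have "?P e = {(a, b), (b, a)}" unfolding e by (auto simp: doubleton_eq_iff)
    with \<open>a \<noteq> b\<close> show ?thesis by simp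
  qed
  have "{(u, v). {u, v} \<in> edges G} = (\<Union>e\<in>edges G. ?P e)" by auto
  also have "card \<dots> = (\<Sum>e\<in>edges G. card (?P e))"
    using card_P by (intro card_UN_disjoint) (auto simp: edges_def)
  also have "\<dots> = 2 * graph_size G" using card_P by (simp add: graph_size_def)
  finally show ?thesis .
qed

lemma edges_subset_verts:
  assumes "graph G" "{u, v} \<in> edges G"
  shows "u \<in> verts G" "v \<in> verts G"
proof -
  interpret graph G by fact
  show "u \<in> verts G" "v \<in> verts G"
    using assms(2) unfolding edges_def by (auto simp: doubleton_eq_iff)
qed

theorem theorem4p1:
  fixes G :: "('v, 'e) pre_digraph" and S :: "'v set" and vs :: "'v list"
    and n m \<sigma> :: nat
  assumes "graph G"
    and "card (verts G) = n" and "n \<ge> 2"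
    and "graph_size G = m" and "m \<ge> 1"
    and "S \<subseteq> verts G" and "card S = \<sigma>"
    and "vertex_enum G vs"
  shows "lambda1 G S vs \<le> real \<sigma> / real n
    + sqrt (real \<sigma> * (real n - 1) * (real n - real \<sigma>) / (real n)\<^sup>2
            + 2 * real m * (real n - 1) / real n)"
proof -
  define A where "A = self_loop_adj_matrix G S vs"
  have vs: "bij_betw ((!) vs) {..<n} (verts G)"
    using assms(2,8) bij_betw_nth[of vs "{..<n}" "verts G"]
    unfolding vertex_enum_def by (metis distinct_card)
  have len: "length vs = n" using assms(2,8) unfolding vertex_enum_def by (metis distinct_card)
  have A: "A \<in> carrier_mat n n"
    unfolding A_def self_loop_adj_matrix_def adj_matrix_def loop_matrix_def by (simp add: len)
  have A_entry: "A $$ (i, j) = of_bool ({vs ! i, vs ! j} \<in> edges G) + of_bool (i = j \<and> vs ! i \<in> S)"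
    if "i < n" "j < n" for i j
    using that len unfolding A_def self_loop_adj_matrix_def adj_matrix_def loop_matrix_def by auto
  note no_loop = singleton_notin_edges[OF assms(1)]
  \<comment> \<open>An infinite set has \<open>card\<close> 0, which \<open>n \<ge> 2\<close>
    excludes.\<close>
  have finV: "finite (verts G)" using assms(2,3) by (metis card.infinite not_numeral_le_zero)
  have loops: "(\<Sum>i<n. of_bool (vs ! i \<in> S)) = real \<sigma>"
  proof -
    have "(\<Sum>i<n. of_bool (vs ! i \<in> S)) = (\<Sum>u\<in>verts G. of_bool (u \<in> S) :: real)"
      by (rule sum.reindex_bij_betw[OF vs])
    also have "\<dots> = real \<sigma>" using finV assms(6,7) by (simp add: sum_of_bool_eq Int_absorb1)
    finally show ?thesis .
  qed
  have trace: "(\<Sum>i<n. A $$ (i, i)) = \<sigma>"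
    using loops by (simp add: A_entry no_loop)
  have "(\<Sum>i<n. \<Sum>j<n. of_bool ({vs ! i, vs ! j} \<in> edges G))
      = (\<Sum>u\<in>verts G. \<Sum>v\<in>verts G. of_bool ({u, v} \<in> edges G) :: real)"
    by (simp only: sum.reindex_bij_betw[OF vs, of "\<lambda>v. of_bool ({u, v} \<in> edges G)" for u]
        sum.reindex_bij_betw[OF vs, of "\<lambda>u. \<Sum>v\<in>verts G. of_bool ({u, v} \<in> edges G)"])
  also have "\<dots> = (\<Sum>(u, v)\<in>verts G \<times> verts G. of_bool ({u, v} \<in> edges G))"
    by (rule sum.cartesian_product)
  also have "\<dots> = card {(u, v). {u, v} \<in> edges G}"
  proof -
    have "verts G \<times> verts G \<inter> {p. {fst p, snd p} \<in> edges G} = {(u, v). {u, v} \<in> edges G}"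
      using edges_subset_verts[OF assms(1)] by auto
    then show ?thesis using finV by (simp add: case_prod_beta sum_of_bool_eq)
  qed
  also have "\<dots> = 2 * real m" by (simp add: card_adjacent_pairs[OF assms(1)] assms(4))
  finally have adjacent: "(\<Sum>i<n. \<Sum>j<n. of_bool ({vs ! i, vs ! j} \<in> edges G)) = 2 * real m" .
  \<comment> \<open>An edge entry lies off the diagonal and a loop entry on it, so the two never add
    up to 2: all entries are 0 or 1 and equal their squares.\<close>
  have "(A $$ (i, j))\<^sup>2 = of_bool ({vs ! i, vs ! j} \<in> edges G)
      + (if i = j then of_bool (vs ! i \<in> S) else 0)" if "i < n" "j < n" for i j
    using that no_loop by (auto simp: A_entry)
  then have "(\<Sum>i<n. \<Sum>j<n. (A $$ (i, j))\<^sup>2)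
      = (\<Sum>i<n. \<Sum>j<n. of_bool ({vs ! i, vs ! j} \<in> edges G)
          + (if i = j then of_bool (vs ! i \<in> S) else 0))"
    by (intro sum.cong refl) simp
  also have "\<dots> = 2 * real m + \<sigma>"
    by (simp add: sum.distrib adjacent loops del: sum_of_bool_eq)
  finally have frob: "(\<Sum>i<n. \<Sum>j<n. (A $$ (i, j))\<^sup>2) = 2 * real m + \<sigma>" .
  have "n > 0" using assms(3) by simp
  moreover have "A $$ (i, j) = A $$ (j, i)" if "i < n" "j < n" for i j
    using that by (cases "i = j") (auto simp: A_entry insert_commute)
  ultimately have "spectrum A \<noteq> {}" by (intro symmetric_spectrum_nonempty[OF A])
  \<comment> \<open>The maximum of a finite nonempty set belongs to it.\<close>
  then have "eigenvalue A (lambda1 G S vs)"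
    using Max_in[OF card_finite_spectrum(1)[OF A]]
    unfolding lambda1_def largest_eigenvalue_def A_def[symmetric] spectrum_def by simp
  from eigenvalue_trace_bound[OF A \<open>n > 0\<close> this]
  have "(lambda1 G S vs - real \<sigma> / n)\<^sup>2 \<le> (2 * real m + \<sigma> - (real \<sigma>)\<^sup>2 / n) * (1 - 1 / n)"
    by (simp only: trace frob)
  also have "\<dots> = real \<sigma> * (real n - 1) * (real n - real \<sigma>) / (real n)\<^sup>2
      + 2 * real m * (real n - 1) / real n"
    using \<open>n > 0\<close> by (simp add: field_simps power2_eq_square)
  \<comment> \<open>A bound on the square suffices here, whatever the sign of the left-hand
    side.\<close>
  finally have "lambda1 G S vs - real \<sigma> / n \<le> sqrt (real \<sigma> * (real n - 1) * (real n - real \<sigma>) / (real n)\<^sup>2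
      + 2 * real m * (real n - 1) / real n)"
    by (rule real_le_rsqrt)
  then show ?thesis by simp
qed

end
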